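(* Let $X$ be a finite-dimensional, strictly convex and smooth real Banach space and let $M, N\subset X$ be linear subspaces. If $P_{M\cap N}$ is linear, then $R_{M,N} = R_{N,M} = P_{M\cap N}$.
   Context: For a finite-dimensional strictly convex Banach space $X$ and a linear subspace $L\subset X$, the metric projection $P_L\colon X\to X$ sends $x$ to the unique point $P_Lx\in L$ with $\|x-P_Lx\|=d(x,L)$; it is in general nonlinear. When $X$ is finite-dimensional, strictly convex and smooth (the norm is Gâteaux differentiable away from the origin), the alternating projections converge pointwise, and one defines $R_{M,N}x:=\lim_{n\to\infty}(P_MP_N)^nx$ and $R_{N,M}x:=\lim_{n\to\infty}(P_NP_M)^nx$ for $x\in X$; both limits lie in $M\cap N$. *)

theory Defs
  imports "HOL-Analysis.Analysis"
begin

text \<open>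
  Properties of a normed space are stated as predicates on the type carrying it. The class
  \<open>euclidean_space\<close> is not suitable for finite dimensionality here, since it forces
  the norm to come from an inner product.
\<close>

definition finite_dim_space :: "'a::real_vector itself \<Rightarrow> bool" where
  "finite_dim_space _ \<longleftrightarrow> (\<exists>B::'a set. finite B \<and> span B = UNIV)"

definition strictly_convex_space :: "'a::real_normed_vector itself \<Rightarrow> bool" where
  "strictly_convex_space _ \<longleftrightarrow>
     (\<forall>x y::'a. norm x = 1 \<longrightarrow> norm y = 1 \<longrightarrow> x \<noteq> y \<longrightarrow> norm ((1 / 2) *\<^sub>R (x + y)) < 1)"

definition gateaux_differentiable_at ::
    "('a::real_normed_vector \<Rightarrow> 'b::real_normed_vector) \<Rightarrow> 'a \<Rightarrow> bool" where
  "gateaux_differentiable_at f x \<longleftrightarrow>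
     (\<exists>f'. bounded_linear f' \<and>
        (\<forall>h. ((\<lambda>t::real. (f (x + t *\<^sub>R h) - f x) /\<^sub>R t) \<longlongrightarrow> f' h) (at 0)))"

definition smooth_space :: "'a::real_normed_vector itself \<Rightarrow> bool" where
  "smooth_space _ \<longleftrightarrow> (\<forall>x::'a. x \<noteq> 0 \<longrightarrow> gateaux_differentiable_at (norm :: 'a \<Rightarrow> real) x)"

text \<open>
  The nearest point exists and is unique when \<open>L\<close> is a subspace of a finite-dimensional
  strictly convex space; otherwise the value may be unspecified.
\<close>

definition metric_proj :: "'a::real_normed_vector set \<Rightarrow> 'a \<Rightarrow> 'a" where
  "metric_proj L x = (THE y. y \<in> L \<and> norm (x - y) = infdist x L)"

text \<open>The limit exists when, in addition, the space is smooth.\<close>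

definition alt_proj_limit :: "'a::real_normed_vector set \<Rightarrow> 'a set \<Rightarrow> 'a \<Rightarrow> 'a" where
  "alt_proj_limit M N x = lim (\<lambda>n. ((metric_proj M \<circ> metric_proj N) ^^ n) x)"

end

theory Submission
  imports Defs
begin

text \<open>
  Write \<open>K = M \<inter> N\<close>. The residual \<open>x - P\<^sub>M x\<close> is Birkhoff-James orthogonal to
  \<open>M\<close>, hence to \<open>K\<close>, so \<open>P\<^sub>K (x - P\<^sub>M x) = 0\<close>. When \<open>P\<^sub>K\<close> is linear this says
  \<open>P\<^sub>K P\<^sub>M x = P\<^sub>K x\<close>, and likewise for \<open>N\<close>: the alternating projections never
  change the \<open>P\<^sub>K\<close>-part \<open>p = P\<^sub>K x\<close> of the starting point. After subtracting \<open>p\<close>, all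
  iterates lie in the subspace \<open>W = ker P\<^sub>K\<close>, a complement of \<open>K\<close>, so they alternate between
  \<open>M \<inter> W\<close> and \<open>N \<inter> W\<close>, which meet only in \<open>0\<close>. It remains to see that they tend
  to \<open>0\<close>.

  Two subspaces \<open>A\<close>, \<open>B\<close> with \<open>A \<inter> B = {0}\<close> have a positive angle by compactness
  (\<open>subspaces_positive_angle\<close>), so the distances \<open>d\<^sub>n\<close> between consecutive iterates control the
  iterates themselves. These distances decrease to some \<open>d\<close>, and a cluster point \<open>(a, b)\<close> of the
  iterates realises \<open>d\<close> as the distance from \<open>a\<close> to \<open>B\<close> and from \<open>b\<close> to \<open>A\<close>. If \<open>d > 0\<close>,
  the derivative of the norm at \<open>a - b\<close> therefore vanishes on \<open>A\<close> and on \<open>B\<close>, hence at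
  \<open>a - b\<close> itself; but Euler's identity gives it the value \<open>norm (a - b)\<close> there. This is where
  smoothness enters (\<open>orthogonal_to_both_imp_zero\<close>): without it, different supporting
  functionals could be responsible for the two orthogonality relations.
\<close>

section \<open>Compactness in finite-dimensional normed spaces\<close>

lemma closed_if_compact_Int_cball:
  fixes S :: "'a::real_normed_vector set"
  assumes "\<And>r. compact (S \<inter> cball 0 r)"
  shows "closed S"
  unfolding closed_sequential_limits
proof (intro allI impI, elim conjE)
  fix x l assume x: "\<forall>n. x n \<in> S" and lim: "x \<longlonglongrightarrow> l"
  obtain r where r: "\<And>n. norm (x n) \<le> r"
    using convergent_imp_Bseq[of x] lim by (auto simp: convergent_def Bseq_def)
  have "closed (S \<inter> cball 0 r)" using assms by (rule compact_imp_closed)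
  moreover have "x n \<in> S \<inter> cball 0 r" for n using x r by auto
  ultimately have "l \<in> S \<inter> cball 0 r"
    using lim closed_sequentially by metis
  then show "l \<in> S" by simp
qed

text \<open>
  Induction on the spanning set. If \<open>b\<close> is at distance \<open>\<delta> > 0\<close> from the closed subspace
  \<open>span B\<close>, then \<open>\<bar>t\<bar> * \<delta> \<le> norm (t *\<^sub>R b + y)\<close>, so a ball of the larger span is covered by a
  continuous image of an interval times a ball of \<open>span B\<close>.
\<close>

lemma compact_span_Int_cball:
  fixes B :: "'a::real_normed_vector set"
  assumes "finite B"
  shows "compact (span B \<inter> cball 0 r)"
  using assms
proof (induction B arbitrary: r rule: finite_induct)
  case empty
  have "({0} :: 'a set) \<inter> cball 0 r = {} \<or> ({0} :: 'a set) \<inter> cball 0 r = {0}" by auto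
  then show ?case by auto
next
  case (insert b B)
  show ?case
  proof (cases "b \<in> span B")
    case True
    then show ?thesis using insert.IH by (simp add: span_redundant)
  next
    case False
    have cl: "closed (span B)" by (rule closed_if_compact_Int_cball) (rule insert.IH)
    have ne: "span B \<noteq> {}" using span_zero by blast
    define \<delta> where "\<delta> = infdist b (span B)"
    have \<delta>: "\<delta> > 0"
      using False cl ne in_closed_iff_infdist_zero[OF cl ne] infdist_nonneg[of b "span B"]
      by (auto simp: \<delta>_def less_le)
    define R where "R = r + r / \<delta> * norm b"
    define I where "I = (\<lambda>p. fst p *\<^sub>R b + snd p) ` ({-(r/\<delta>)..r/\<delta>} \<times> (span B \<inter> cball 0 R))"
    have "compact I"
      unfolding I_def
      by (intro compact_continuous_image continuous_intros compact_Times insert.IH compact_Icc)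
    moreover have "span (insert b B) \<inter> cball 0 r = I \<inter> cball 0 r"
    proof (intro equalityI subsetI)
      fix x assume x: "x \<in> span (insert b B) \<inter> cball 0 r"
      then obtain t where t: "x - t *\<^sub>R b \<in> span B" by (auto simp: span_insert)
      have tb: "\<bar>t\<bar> * \<delta> \<le> norm x"
      proof (cases "t = 0")
        case False
        have "- (1/t) *\<^sub>R (x - t *\<^sub>R b) \<in> span B" using t by (rule span_scale)
        then have "\<delta> \<le> dist b (- (1/t) *\<^sub>R (x - t *\<^sub>R b))"
          unfolding \<delta>_def by (rule infdist_le)
        also have "b - (- (1/t) *\<^sub>R (x - t *\<^sub>R b)) = (1/t) *\<^sub>R x"
          using False by (simp add: algebra_simps)
        then have "dist b (- (1/t) *\<^sub>R (x - t *\<^sub>R b)) = norm x / \<bar>t\<bar>"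
          by (simp add: dist_norm)
        finally show ?thesis using False by (simp add: field_simps)
      qed simp
      then have t2: "\<bar>t\<bar> \<le> r / \<delta>" using x \<delta> by (simp add: field_simps)
      have "norm (x - t *\<^sub>R b) \<le> norm x + \<bar>t\<bar> * norm b"
        by (metis norm_triangle_ineq4 norm_scaleR)
      also have "\<dots> \<le> R"
        unfolding R_def using x t2 by (intro add_mono mult_right_mono) auto
      finally have "(t, x - t *\<^sub>R b) \<in> {-(r/\<delta>)..r/\<delta>} \<times> (span B \<inter> cball 0 R)"
        using t t2 by auto
      then have "fst (t, x - t *\<^sub>R b) *\<^sub>R b + snd (t, x - t *\<^sub>R b) \<in> I"
        unfolding I_def by (rule imageI)
      then show "x \<in> I \<inter> cball 0 r" using x by simp
    next
      fix x assume x: "x \<in> I \<inter> cball 0 r"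
      then obtain t y where "x = t *\<^sub>R b + y" "y \<in> span B" by (auto simp: I_def)
      then have "x - t *\<^sub>R b \<in> span B" by simp
      then show "x \<in> span (insert b B) \<inter> cball 0 r"
        using x by (auto simp: span_insert)
    qed
    ultimately show ?thesis by (simp add: compact_Int_closed)
  qed
qed

lemma finite_dim_compact_cball:
  assumes "finite_dim_space TYPE('a::real_normed_vector)"
  shows "compact (cball (0::'a) r)"
proof -
  obtain T :: "'a set" where "finite T" "span T = UNIV"
    using assms by (auto simp: finite_dim_space_def)
  then show ?thesis using compact_span_Int_cball[of T r] by simp
qed

lemma finite_dim_closed_subspace:
  fixes S :: "'a::real_normed_vector set"
  assumes "finite_dim_space TYPE('a)" "subspace S"
  shows "closed S"
proof -
  obtain T :: "'a set" where T: "finite T" "span T = UNIV"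
    using assms(1) by (auto simp: finite_dim_space_def)
  obtain B where B: "B \<subseteq> S" "independent B" "S \<subseteq> span B"
    using maximal_independent_subset[of S] by blast
  have "finite B" using independent_span_bound[of T B] T B by auto
  moreover have "span B = S" using B assms(2) by (metis span_subspace)
  ultimately show ?thesis using closed_if_compact_Int_cball compact_span_Int_cball by metis
qed

lemma finite_dim_bounded_convergent_subseq:
  fixes x :: "nat \<Rightarrow> 'a::real_normed_vector"
  assumes "finite_dim_space TYPE('a)" "\<And>n. norm (x n) \<le> r"
  obtains l s where "strict_mono (s :: nat \<Rightarrow> nat)" "(x \<circ> s) \<longlonglongrightarrow> l"
proof -
  have "seq_compact (cball (0::'a) r)"
    using finite_dim_compact_cball[OF assms(1)] by (simp add: compact_eq_seq_compact_metric)
  then show ?thesis using assms(2) that unfolding seq_compact_def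
    by (metis mem_cball_0)
qed

section \<open>Best approximation in subspaces\<close>

text \<open>Two distinct nearest points would have a strictly nearer midpoint.\<close>

lemma metric_proj_eqI:
  fixes L :: "'a::real_normed_vector set"
  assumes sc: "strictly_convex_space TYPE('a)" and L: "subspace L"
    and y: "y \<in> L" and best: "\<And>w. w \<in> L \<Longrightarrow> norm (x - y) \<le> norm (x - w)"
  shows "metric_proj L x = y"
proof -
  have dist_eq: "infdist x L = norm (x - y)"
  proof (rule antisym)
    show "infdist x L \<le> norm (x - y)" using infdist_le[OF y, of x] by (simp add: dist_norm)
    show "norm (x - y) \<le> infdist x L"
      using y best by (auto simp: infdist_def dist_norm intro!: cINF_greatest)
  qed
  have uniq: "z = y" if z: "z \<in> L" "norm (x - z) = norm (x - y)" for z
  proof (rule ccontr)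
    assume "z \<noteq> y"
    define r where "r = norm (x - y)"
    have r: "r > 0" using z \<open>z \<noteq> y\<close> unfolding r_def by (metis norm_eq_zero eq_iff_diff_eq_0 zero_less_norm_iff)
    define a b where "a = (1/r) *\<^sub>R (x - y)" and "b = (1/r) *\<^sub>R (x - z)"
    have "norm a = 1" "norm b = 1" using r z(2) by (auto simp: a_def b_def r_def)
    moreover have "a \<noteq> b" using \<open>z \<noteq> y\<close> r by (auto simp: a_def b_def)
    ultimately have lt: "norm ((1/2) *\<^sub>R (a + b)) < 1"
      using sc by (auto simp: strictly_convex_space_def)
    have "(1/2) *\<^sub>R (a + b) = (1/r) *\<^sub>R ((1/2) *\<^sub>R ((x - y) + (x - z)))"
      by (simp add: a_def b_def algebra_simps)
    also have "(1/2) *\<^sub>R ((x - y) + (x - z)) = x - (1/2) *\<^sub>R (y + z)"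
      by (simp add: algebra_simps flip: scaleR_add_left)
    finally have "norm ((1/2) *\<^sub>R (a + b)) = norm (x - (1/2) *\<^sub>R (y + z)) / r"
      using r by simp
    then have "norm (x - (1/2) *\<^sub>R (y + z)) < r" using lt r by simp
    moreover have "(1/2) *\<^sub>R (y + z) \<in> L" using L y z by (intro subspace_scale subspace_add)
    ultimately show False using best[of "(1/2) *\<^sub>R (y + z)"] by (simp add: r_def)
  qed
  show ?thesis unfolding metric_proj_def
    by (rule the_equality) (use y dist_eq uniq in auto)
qed

lemma metric_proj_nearest:
  fixes L :: "'a::real_normed_vector set"
  assumes fd: "finite_dim_space TYPE('a)" and sc: "strictly_convex_space TYPE('a)"
    and L: "subspace L"
  shows "metric_proj L x \<in> L" "w \<in> L \<Longrightarrow> norm (x - metric_proj L x) \<le> norm (x - w)"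
proof -
  have zero: "0 \<in> L" using L by (rule subspace_0)
  \<comment> \<open>Points of norm above \<open>2 * norm x\<close> are farther from \<open>x\<close> than \<open>0\<close> is.\<close>
  define C where "C = L \<inter> cball 0 (2 * norm x)"
  have "compact C" unfolding C_def
    using finite_dim_closed_subspace[OF fd L] finite_dim_compact_cball[OF fd]
    by (metis closed_Int_compact)
  moreover have "C \<noteq> {}" using zero by (auto simp: C_def)
  moreover have "continuous_on C (\<lambda>y. norm (x - y))" by (intro continuous_intros)
  ultimately obtain y where y: "y \<in> C" "\<And>w. w \<in> C \<Longrightarrow> norm (x - y) \<le> norm (x - w)"
    using continuous_attains_inf by metis
  have best: "norm (x - y) \<le> norm (x - w)" if "w \<in> L" for w
  proof (cases "norm w \<le> 2 * norm x")
    case True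
    then show ?thesis using y(2) that by (auto simp: C_def)
  next
    case False
    have "norm (x - y) \<le> norm (x - 0)" using zero by (intro y(2)) (auto simp: C_def)
    moreover have "norm w \<le> norm x + norm (x - w)"
      by (metis norm_triangle_sub norm_minus_commute)
    ultimately show ?thesis using False by simp
  qed
  have "metric_proj L x = y" using y(1) best by (intro metric_proj_eqI sc L) (auto simp: C_def)
  then show "metric_proj L x \<in> L" "w \<in> L \<Longrightarrow> norm (x - metric_proj L x) \<le> norm (x - w)"
    using y(1) best by (auto simp: C_def)
qed

text \<open>
  The residual of the projection to \<open>M\<close> is orthogonal to \<open>M\<close>, hence to \<open>K\<close>, so \<open>P\<^sub>K\<close> kills it;
  linearity turns this into the tower law that holds for orthogonal projections.
\<close>

lemma linear_metric_proj_absorbs: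
  fixes K M :: "'a::real_normed_vector set"
  assumes fd: "finite_dim_space TYPE('a)" and sc: "strictly_convex_space TYPE('a)"
    and M: "subspace M" and K: "subspace K" and "K \<subseteq> M" and lin: "linear (metric_proj K)"
  shows "metric_proj K (metric_proj M x) = metric_proj K x"
proof -
  have "metric_proj K (x - metric_proj M x) = 0"
  proof (rule metric_proj_eqI[OF sc K subspace_0[OF K]])
    fix k assume "k \<in> K"
    then have "metric_proj M x + k \<in> M"
      using metric_proj_nearest(1)[OF fd sc M] M \<open>K \<subseteq> M\<close> by (auto intro: subspace_add)
    then show "norm (x - metric_proj M x - 0) \<le> norm (x - metric_proj M x - k)"
      using metric_proj_nearest(2)[OF fd sc M] by (metis diff_diff_add diff_zero)
  qed
  then show ?thesis using lin by (simp add: linear_diff)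
qed

section \<open>Alternating best approximation between two subspaces\<close>

text \<open>A differentiable function has vanishing derivative along directions in which it is minimal.\<close>

lemma gateaux_norm_derivative_zero:
  fixes v h :: "'a::real_normed_vector"
  assumes f: "((\<lambda>t::real. (norm (v + t *\<^sub>R h) - norm v) /\<^sub>R t) \<longlongrightarrow> c) (at 0)"
    and min: "\<And>t. norm v \<le> norm (v + t *\<^sub>R h)"
  shows "c = 0"
proof (rule antisym)
  have right: "((\<lambda>t::real. (norm (v + t *\<^sub>R h) - norm v) /\<^sub>R t) \<longlongrightarrow> c) (at_right 0)"
    and left: "((\<lambda>t::real. (norm (v + t *\<^sub>R h) - norm v) /\<^sub>R t) \<longlongrightarrow> c) (at_left 0)"
    using f by (auto simp: filterlim_split_at_real filterlim_at_split)
  show "0 \<le> c"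
    using min by (intro tendsto_lowerbound[OF right])
      (auto simp: eventually_at_filter intro!: always_eventually)
  show "c \<le> 0"
    using min by (intro tendsto_upperbound[OF left])
      (auto simp: eventually_at_filter mult_nonpos_nonneg intro!: always_eventually)
qed

text \<open>
  The derivative of the norm at \<open>v \<noteq> 0\<close> is linear, vanishes on \<open>A\<close> and on \<open>B\<close>, hence on
  \<open>v = a - b\<close>, whereas by homogeneity of the norm its value at \<open>v\<close> is \<open>norm v\<close>.
\<close>

lemma orthogonal_to_both_imp_zero:
  fixes A B :: "'a::real_normed_vector set"
  assumes smooth: "smooth_space TYPE('a)"
    and A: "subspace A" "a \<in> A" and B: "subspace B" "b \<in> B"
    and perpA: "\<And>h. h \<in> A \<Longrightarrow> norm (a - b) \<le> norm (a - b + h)"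
    and perpB: "\<And>h. h \<in> B \<Longrightarrow> norm (a - b) \<le> norm (a - b + h)"
  shows "a = b"
proof (rule ccontr)
  assume "a \<noteq> b"
  define v where "v = a - b"
  have v: "v \<noteq> 0" using \<open>a \<noteq> b\<close> by (simp add: v_def)
  obtain f' where f': "bounded_linear f'"
    and lim: "\<And>h. ((\<lambda>t::real. (norm (v + t *\<^sub>R h) - norm v) /\<^sub>R t) \<longlongrightarrow> f' h) (at 0)"
    using smooth v by (auto simp: smooth_space_def gateaux_differentiable_at_def)
  have "f' a = 0"
    by (rule gateaux_norm_derivative_zero[OF lim])
       (use A perpA in \<open>auto simp: v_def intro: subspace_scale\<close>)
  moreover have "f' b = 0"
    by (rule gateaux_norm_derivative_zero[OF lim])
       (use B perpB in \<open>auto simp: v_def intro: subspace_scale\<close>)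
  ultimately have "f' v = 0"
    using f' by (simp add: v_def linear_diff bounded_linear.linear)
  moreover have "f' v = norm v"
  proof (rule tendsto_unique[OF _ lim])
    have "eventually (\<lambda>t. (norm (v + t *\<^sub>R v) - norm v) /\<^sub>R t = norm v) (at (0::real))"
      unfolding eventually_at
    proof (intro exI[of _ 1] conjI ballI impI)
      fix t :: real assume t: "t \<noteq> 0 \<and> dist t 0 < 1"
      have "v + t *\<^sub>R v = (1 + t) *\<^sub>R v" by (simp add: algebra_simps)
      then have "norm (v + t *\<^sub>R v) = (1 + t) * norm v"
        using t by (simp add: dist_norm abs_if split: if_splits)
      then show "(norm (v + t *\<^sub>R v) - norm v) /\<^sub>R t = norm v"
        using t by (simp add: algebra_simps)
    qed simp
    then show "((\<lambda>t::real. (norm (v + t *\<^sub>R v) - norm v) /\<^sub>R t) \<longlongrightarrow> norm v) (at 0)"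
      by (rule tendsto_eventually)
  qed simp
  ultimately show False using v by simp
qed

text \<open>
  The distance to \<open>B\<close> is continuous and positive on the compact unit sphere of \<open>A\<close>; its minimum
  there serves as \<open>c\<close>, and the general case follows by scaling.
\<close>

lemma subspaces_positive_angle:
  fixes A B :: "'a::real_normed_vector set"
  assumes fd: "finite_dim_space TYPE('a)"
    and A: "subspace A" and B: "subspace B" and AB: "A \<inter> B = {0}"
  obtains c where "c > 0" "\<And>a b. a \<in> A \<Longrightarrow> b \<in> B \<Longrightarrow> c * norm a \<le> norm (a - b)"
proof (cases "A = {0}")
  case True
  then show ?thesis using that[of 1] by auto
next
  case False
  have clA: "closed A" and clB: "closed B" using fd A B by (auto intro: finite_dim_closed_subspace)
  define S where "S = A \<inter> sphere 0 1"
  have "S = A \<inter> (cball 0 1 - ball 0 1)" by (auto simp: S_def)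
  then have "compact S"
    using clA finite_dim_compact_cball[OF fd, of 1]
    by (simp add: closed_Int_compact compact_diff)
  moreover obtain a0 where a0: "a0 \<in> A" "a0 \<noteq> 0" using False subspace_0[OF A] by auto
  have "(1 / norm a0) *\<^sub>R a0 \<in> S" using a0 A by (auto simp: S_def subspace_scale)
  then have "S \<noteq> {}" by auto
  moreover have "continuous_on S (\<lambda>a. infdist a B)" by (intro continuous_intros)
  ultimately obtain s where s: "s \<in> S" "\<And>a. a \<in> S \<Longrightarrow> infdist s B \<le> infdist a B"
    using continuous_attains_inf by metis
  define c where "c = infdist s B"
  have sA: "s \<in> A" "norm s = 1" using s(1) by (simp_all add: S_def)
  have "s \<notin> B"
  proof
    assume "s \<in> B"
    with sA(1) have "s \<in> A \<inter> B" by blast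
    then have "s = 0" unfolding AB by simp
    then show False using sA(2) by simp
  qed
  moreover have "B \<noteq> {}" using subspace_0[OF B] by blast
  ultimately have "c \<noteq> 0" unfolding c_def using in_closed_iff_infdist_zero[OF clB] by blast
  then have "c > 0" using infdist_nonneg[of s B] unfolding c_def by linarith
  moreover have "c * norm a \<le> norm (a - b)" if "a \<in> A" "b \<in> B" for a b
  proof (cases "a = 0")
    case False
    have "(1 / norm a) *\<^sub>R a \<in> S" using that A False by (auto simp: S_def subspace_scale)
    then have "c \<le> infdist ((1 / norm a) *\<^sub>R a) B" unfolding c_def by (rule s(2))
    also have "\<dots> \<le> dist ((1 / norm a) *\<^sub>R a) ((1 / norm a) *\<^sub>R b)"
      using that B by (intro infdist_le subspace_scale)
    also have "\<dots> = norm (a - b) / norm a"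
      by (simp add: dist_norm flip: scaleR_diff_right)
    finally show ?thesis using False by (simp add: field_simps)
  qed simp
  ultimately show ?thesis by (rule that)
qed

text \<open>
  The step lengths decrease and, by the positive angle, dominate the iterates. So the sequence is
  bounded, and a cluster point attains the limiting step length in both directions;
  smoothness forces that length to be \<open>0\<close>.
\<close>

lemma alternating_nearest_points_tendsto_zero:
  fixes A B :: "'a::real_normed_vector set"
  assumes fd: "finite_dim_space TYPE('a)" and smooth: "smooth_space TYPE('a)"
    and A: "subspace A" and B: "subspace B" and AB: "A \<inter> B = {0}"
    and u: "\<And>n. u n \<in> A" and v: "\<And>n. v n \<in> B"
    and near_v: "\<And>n y. y \<in> B \<Longrightarrow> norm (u n - v n) \<le> norm (u n - y)"
    and near_u: "\<And>n y. y \<in> A \<Longrightarrow> norm (u (Suc n) - v n) \<le> norm (y - v n)"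
  shows "u \<longlonglongrightarrow> 0"
proof -
  obtain c where c: "c > 0" "\<And>a b. a \<in> A \<Longrightarrow> b \<in> B \<Longrightarrow> c * norm a \<le> norm (a - b)"
    using subspaces_positive_angle[OF fd A B AB] by metis
  define d where "d n = norm (u n - v n)" for n
  have step: "d (Suc n) \<le> norm (y - v n)" if "y \<in> A" for n y
    using near_v[OF v[of n], of "Suc n"] near_u[OF that, of n] by (simp add: d_def)
  have dec: "decseq d"
    by (rule decseq_SucI) (use step[OF u] in \<open>simp add: d_def\<close>)
  then obtain D where D: "d \<longlonglongrightarrow> D"
    using decseq_convergent[of d 0] by (auto simp: d_def)
  have ub: "norm (u n) \<le> d 0 / c" for n
  proof -
    have "c * norm (u n) \<le> d n" using c(2)[OF u v] by (simp add: d_def)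
    also have "\<dots> \<le> d 0" using dec by (simp add: decseq_def)
    finally show ?thesis using c(1) by (simp add: field_simps)
  qed
  have vb: "norm (v n) \<le> d 0 / c + d 0" for n
  proof -
    have "norm (v n) \<le> norm (u n) + d n"
      unfolding d_def by (metis norm_triangle_sub norm_minus_commute)
    also have "\<dots> \<le> d 0 / c + d 0" using ub dec by (intro add_mono) (auto simp: decseq_def)
    finally show ?thesis .
  qed
  obtain a s where s: "strict_mono s" "(u \<circ> s) \<longlonglongrightarrow> a"
    by (rule finite_dim_bounded_convergent_subseq[OF fd ub])
  have "norm ((v \<circ> s) n) \<le> d 0 / c + d 0" for n using vb by simp
  then obtain b s' where s': "strict_mono s'" "((v \<circ> s) \<circ> s') \<longlonglongrightarrow> b"
    by (rule finite_dim_bounded_convergent_subseq[OF fd])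
  define r where "r = s \<circ> s'"
  have r: "strict_mono r" using s(1) s'(1) by (simp add: r_def strict_mono_o)
  have ur: "(\<lambda>n. u (r n)) \<longlonglongrightarrow> a"
    using LIMSEQ_subseq_LIMSEQ[OF s(2) s'(1)] by (simp add: r_def comp_def)
  have vr: "(\<lambda>n. v (r n)) \<longlonglongrightarrow> b" using s'(2) by (simp add: r_def comp_def)
  have dr: "(\<lambda>n. d (r n)) \<longlonglongrightarrow> D"
    using LIMSEQ_subseq_LIMSEQ[OF D r] by (simp add: comp_def)
  \<comment> \<open>The estimate \<open>step\<close> bounds the step that follows \<open>v (r n)\<close>, which need not belong to the
    subsequence; its length has the same limit because the whole sequence \<open>d\<close> converges.\<close>
  have dr': "(\<lambda>n. d (Suc (r n))) \<longlonglongrightarrow> D"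
    using LIMSEQ_subseq_LIMSEQ[OF LIMSEQ_Suc[OF D] r] by (simp add: comp_def)
  have a: "a \<in> A" using closed_sequentially[OF finite_dim_closed_subspace[OF fd A] _ ur] u by simp
  have b: "b \<in> B" using closed_sequentially[OF finite_dim_closed_subspace[OF fd B] _ vr] v by simp
  have "(\<lambda>n. d (r n)) \<longlonglongrightarrow> norm (a - b)"
    unfolding d_def by (intro tendsto_intros ur vr)
  then have Dab: "D = norm (a - b)" using dr LIMSEQ_unique by blast
  have DB: "D \<le> norm (a - y)" if "y \<in> B" for y
  proof (rule LIMSEQ_le[OF dr])
    show "(\<lambda>n. norm (u (r n) - y)) \<longlonglongrightarrow> norm (a - y)" by (intro tendsto_intros ur)
  qed (use near_v that in \<open>auto simp: d_def\<close>)
  have DA: "D \<le> norm (y - b)" if "y \<in> A" for y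
  proof (rule LIMSEQ_le[OF dr'])
    show "(\<lambda>n. norm (y - v (r n))) \<longlonglongrightarrow> norm (y - b)" by (intro tendsto_intros vr)
  qed (use step that in auto)
  have "a = b"
  proof (rule orthogonal_to_both_imp_zero[OF smooth A a B b])
    fix h assume "h \<in> A"
    then show "norm (a - b) \<le> norm (a - b + h)"
      using DA[of "a + h"] a A Dab by (simp add: subspace_add algebra_simps)
  next
    fix h assume "h \<in> B"
    then show "norm (a - b) \<le> norm (a - b + h)"
      using DB[of "b - h"] b B Dab by (simp add: subspace_diff algebra_simps)
  qed
  then have "d \<longlonglongrightarrow> 0" using D Dab by simp
  then have lim: "(\<lambda>n. d n / c) \<longlonglongrightarrow> 0" by (rule tendsto_divide_zero)
  have "norm (u n) \<le> d n / c" for n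
    using c(1) c(2)[OF u[of n] v[of n]] by (simp add: d_def field_simps)
  then show ?thesis by (intro Lim_null_comparison[OF _ lim] always_eventually) simp
qed

section \<open>The limit of alternating projections\<close>

text \<open>
  Subtracting \<open>p = P\<^sub>K x\<close> moves the iterates into \<open>ker P\<^sub>K\<close>, where the traces of \<open>M\<close> and
  \<open>N\<close> meet only in \<open>0\<close>.
\<close>

lemma alternating_projections_tendsto:
  fixes M N :: "'a::real_normed_vector set"
  assumes fd: "finite_dim_space TYPE('a)" and sc: "strictly_convex_space TYPE('a)"
    and smooth: "smooth_space TYPE('a)"
    and M: "subspace M" and N: "subspace N" and lin: "linear (metric_proj (M \<inter> N))"
  shows "(\<lambda>n. ((metric_proj M \<circ> metric_proj N) ^^ n) x) \<longlonglongrightarrow> metric_proj (M \<inter> N) x"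
proof -
  define P where "P = metric_proj (M \<inter> N)"
  define T where "T = metric_proj M \<circ> metric_proj N"
  have K: "subspace (M \<inter> N)" using M N by (rule subspace_inter)
  have PM: "P (metric_proj M z) = P z" and PN: "P (metric_proj N z) = P z" for z
    unfolding P_def using linear_metric_proj_absorbs[OF fd sc _ K _ lin] M N by auto
  have iter: "P ((T ^^ n) x) = P x" for n
    by (induction n) (simp_all add: T_def PM PN)
  have fixK: "P k = k" if "k \<in> M \<inter> N" for k
    unfolding P_def using that by (intro metric_proj_eqI sc K) auto
  have pK: "P x \<in> M \<inter> N" unfolding P_def by (rule metric_proj_nearest(1)[OF fd sc K])
  have linP: "linear P" using lin by (simp add: P_def)
  define W where "W = {z. P z = 0}"
  have W: "subspace W" unfolding W_def using linP by (rule linear_subspace_kernel)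
  \<comment> \<open>The shift by one matters: \<open>x\<close> itself need not lie in \<open>M\<close>.\<close>
  define u where "u n = (T ^^ Suc n) x - P x" for n
  define v where "v n = metric_proj N ((T ^^ Suc n) x) - P x" for n
  have Wu: "u n \<in> W" for n
    unfolding W_def u_def mem_Collect_eq linear_diff[OF linP] iter fixK[OF pK] by simp
  have Wv: "v n \<in> W" for n
    unfolding W_def v_def mem_Collect_eq linear_diff[OF linP] PN iter fixK[OF pK] by simp
  have "u \<longlonglongrightarrow> 0"
  proof (rule alternating_nearest_points_tendsto_zero[OF fd smooth, of "M \<inter> W" "N \<inter> W" u v])
    show "subspace (M \<inter> W)" "subspace (N \<inter> W)" using M N W by (auto intro: subspace_inter)
    show "M \<inter> W \<inter> (N \<inter> W) = {0}"
      using fixK subspace_0[OF M] subspace_0[OF N] subspace_0[OF W] by (auto simp: W_def)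
    show "u n \<in> M \<inter> W" for n
      using Wu[of n] pK metric_proj_nearest(1)[OF fd sc M] M
      by (auto simp: u_def T_def intro: subspace_diff)
    show "v n \<in> N \<inter> W" for n
      using Wv[of n] pK metric_proj_nearest(1)[OF fd sc N] N
      by (auto simp: v_def intro: subspace_diff)
    show "norm (u n - v n) \<le> norm (u n - y)" if "y \<in> N \<inter> W" for n y
    proof -
      have "y + P x \<in> N" using that pK N by (auto intro: subspace_add)
      then have "norm ((T ^^ Suc n) x - metric_proj N ((T ^^ Suc n) x))
          \<le> norm ((T ^^ Suc n) x - (y + P x))"
        by (rule metric_proj_nearest(2)[OF fd sc N])
      then show ?thesis unfolding u_def v_def by (simp add: algebra_simps)
    qed
    show "norm (u (Suc n) - v n) \<le> norm (y - v n)" if "y \<in> M \<inter> W" for n y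
    proof -
      define z where "z = metric_proj N ((T ^^ Suc n) x)"
      have "y + P x \<in> M" using that pK M by (auto intro: subspace_add)
      then have "norm (z - metric_proj M z) \<le> norm (z - (y + P x))"
        by (rule metric_proj_nearest(2)[OF fd sc M])
      moreover have "u (Suc n) - v n = - (z - metric_proj M z)"
        by (simp add: u_def v_def z_def T_def)
      moreover have "y - v n = - (z - (y + P x))" by (simp add: v_def z_def)
      ultimately show ?thesis by (simp only: norm_minus_cancel)
    qed
  qed
  then have "(\<lambda>n. (T ^^ Suc n) x) \<longlonglongrightarrow> P x" unfolding u_def by (rule LIM_zero_cancel)
  then have "(\<lambda>n. (T ^^ n) x) \<longlonglongrightarrow> P x" by (rule LIMSEQ_imp_Suc)
  then show ?thesis by (simp add: P_def T_def)
qed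

theorem corollary2p10:
  fixes M N :: "'a::banach set"
  assumes "finite_dim_space TYPE('a)"
    and "strictly_convex_space TYPE('a)"
    and "smooth_space TYPE('a)"
    and "subspace M" and "subspace N"
    and "linear (metric_proj (M \<inter> N))"
  shows "alt_proj_limit M N = metric_proj (M \<inter> N) \<and>
         alt_proj_limit N M = metric_proj (M \<inter> N)"
proof -
  have "alt_proj_limit M N = metric_proj (M \<inter> N)"
    unfolding alt_proj_limit_def
    using alternating_projections_tendsto[OF assms] by (intro ext limI)
  moreover have "alt_proj_limit N M = metric_proj (N \<inter> M)"
    unfolding alt_proj_limit_def
    using alternating_projections_tendsto[OF assms(1-3) assms(5,4)] assms(6)
    by (intro ext limI) (simp add: Int_commute)
  ultimately show ?thesis by (simp add: Int_commute)
qed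

end
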